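(* Let $(X,F)$ be a minimal topological dynamical system and let $\gamma:X\to\mathbb{R}$ be a function. The equation $$\varphi(Fx)-\varphi(x)=\gamma(x),\quad x\in X,$$ has a solution $\varphi\in CB(X)$ if and only if $\gamma\in CB(X)$ and the sums $s_n(x)=\sum_{k=0}^{n}\gamma(F^kx)$ are uniformly bounded, i.e. $\sup_{n\ge 0}\sup_{x\in X}|s_n(x)|<\infty$. Under these conditions the function $$\varphi(x)=\sup_{n\ge 0}\,[-s_n(x)],\quad x\in X,$$ is a continuous bounded solution, and it is the unique solution in $CB(X)$ up to an arbitrary additive constant.
   Context: A topological dynamical system $(X,F)$ consists of a nonempty topological space $X$ (no separation axiom is assumed) and a continuous map $F:X\to X$ ($F$ need not be invertible). It is called minimal if for every $x\in X$ the orbit $O_F(x)=\{F^nx:n\ge 0\}$ is dense in $X$. $CB(X)$ is the space of bounded continuous real-valued functions on $X$. *)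

theory Defs
  imports "HOL-Analysis.Analysis"
begin

text \<open>
  The phase space is the type \<open>'a\<close> itself: the class \<open>topological_space\<close> carries no
  separation axiom, and types are nonempty. The space \<open>CB(X)\<close> is the library set
  \<^const>\<open>bcontfun\<close> at type \<open>'a \<Rightarrow> real\<close>.
\<close>

definition dynamical_system :: "('a::topological_space \<Rightarrow> 'a) \<Rightarrow> bool"
  where "dynamical_system F \<longleftrightarrow> continuous_on UNIV F"

definition orbit :: "('a \<Rightarrow> 'a) \<Rightarrow> 'a \<Rightarrow> 'a set"
  where "orbit F x = {(F ^^ n) x | n :: nat. True}"

definition minimal_system :: "('a::topological_space \<Rightarrow> 'a) \<Rightarrow> bool"
  where "minimal_system F \<longleftrightarrow> dynamical_system F \<and> (\<forall>x. closure (orbit F x) = UNIV)"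

definition cohomological_solution :: "('a \<Rightarrow> 'a) \<Rightarrow> ('a \<Rightarrow> real) \<Rightarrow> ('a \<Rightarrow> real) \<Rightarrow> bool"
  where "cohomological_solution F \<gamma> \<phi> \<longleftrightarrow> (\<forall>x. \<phi> (F x) - \<phi> x = \<gamma> x)"

text \<open>The upper limit \<open>n\<close> is included, so \<open>birkhoff_sum F \<gamma> 0 = \<gamma>\<close>.\<close>

definition birkhoff_sum :: "('a \<Rightarrow> 'a) \<Rightarrow> ('a \<Rightarrow> real) \<Rightarrow> nat \<Rightarrow> 'a \<Rightarrow> real"
  where "birkhoff_sum F \<gamma> n x = (\<Sum>k=0..n. \<gamma> ((F ^^ k) x))"

text \<open>The suprema are taken in \<^typ>\<open>ereal\<close>, where they exist without a boundedness assumption.\<close>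

definition uniformly_bounded_sums :: "('a \<Rightarrow> 'a) \<Rightarrow> ('a \<Rightarrow> real) \<Rightarrow> bool"
  where "uniformly_bounded_sums F \<gamma> \<longleftrightarrow>
    (SUP n. SUP x. ereal \<bar>birkhoff_sum F \<gamma> n x\<bar>) < \<infinity>"

text \<open>
  This supremum is taken in \<^typ>\<open>real\<close>; it has its usual meaning only at points \<open>x\<close> where the
  numbers \<open>- birkhoff_sum F \<gamma> n x\<close> are bounded above.
\<close>

definition sup_solution :: "('a \<Rightarrow> 'a) \<Rightarrow> ('a \<Rightarrow> real) \<Rightarrow> 'a \<Rightarrow> real"
  where "sup_solution F \<gamma> x = (SUP n. - birkhoff_sum F \<gamma> n x)"

end

theory Submission
  imports Defs
begin

text \<open>
  Write \<open>s\<^sub>n\<close> for the Birkhoff sums of \<open>\<gamma>\<close> and \<open>\<phi> = sup\<^sub>n (- s\<^sub>n)\<close>. A bounded solution makes the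
  sums telescope, which bounds them. Conversely let the sums be bounded and \<open>\<gamma>\<close> continuous.

  The cocycle identity \<open>s\<^sub>n\<^sub>+\<^sub>1(x) = \<gamma>(x) + s\<^sub>n(F x)\<close> gives
  \<open>\<phi>(x) = max (- \<gamma>(x)) (\<phi>(F x) - \<gamma>(x))\<close>. Hence \<open>\<phi>\<close> solves the equation as soon as \<open>\<phi> \<ge> 0\<close>.
  Nonnegativity comes from recurrence (\<open>exists_birkhoff_sum_less\<close>): if all the \<open>s\<^sub>n(y)\<close> were at least
  \<open>\<epsilon> > 0\<close>, take \<open>n\<close> for which \<open>s\<^sub>n(y)\<close> is almost maximal and return close to \<open>y\<close>; repeating the same
  \<open>n + 1\<close> steps from there produces a sum that exceeds the supremum.

  Continuity of \<open>\<phi>\<close> is not visible from its formula: a supremum of continuous functions is only lower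
  semicontinuous. Applying the above to \<open>- \<gamma>\<close> yields a second lower semicontinuous function \<open>\<phi>'\<close>
  that solves the equation for \<open>- \<gamma>\<close>, so that \<open>\<phi> + \<phi>'\<close> is lower semicontinuous and invariant. By
  minimality such a function is constant (\<open>invariant_lower_semicontinuous_constant\<close>). So
  \<open>\<phi> = c - \<phi>'\<close> is upper semicontinuous as well. The same constancy statement, applied to the
  difference of two continuous solutions, gives uniqueness.
\<close>

section \<open>Minimal systems\<close>

lemma minimal_system_visits:
  assumes "minimal_system F" "open U" "y \<in> U"
  obtains n where "(F ^^ n) x \<in> U"
proof -
  have "closure (orbit F x) = UNIV"
    using assms(1) by (simp add: minimal_system_def)
  then have "U \<inter> orbit F x \<noteq> {}"
    using assms(2,3) open_Int_closure_eq_empty[of U "orbit F x"] by auto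
  then show thesis
    using that by (auto simp: orbit_def)
qed

lemma continuous_on_iterate:
  assumes "minimal_system F"
  shows "continuous_on UNIV (F ^^ n)"
proof (induction n)
  case (Suc n)
  have "continuous_on ((F ^^ n) ` UNIV) F"
    using assms continuous_on_subset
    by (auto simp: minimal_system_def dynamical_system_def)
  with Suc have "continuous_on UNIV (F \<circ> F ^^ n)"
    by (rule continuous_on_compose)
  then show ?case by simp
qed (simp add: id_def)

text \<open>
  A sublevel set \<open>{g \<le> g x}\<close> is closed and contains the orbit of \<open>x\<close>, so it is the whole space;
  this applies to every \<open>x\<close>, which makes all values of \<open>g\<close> equal.
\<close>

lemma invariant_lower_semicontinuous_constant:
  fixes g :: "'a::topological_space \<Rightarrow> real"
  assumes F: "minimal_system F"
    and lsc: "\<And>a. open {x. a < g x}"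
    and inv: "\<And>x. g (F x) = g x"
  shows "g x = g y"
proof -
  have orbit: "g ((F ^^ n) x) = g x" for n x
    by (induction n) (simp_all add: inv)
  have "g y \<le> g x" for x y
  proof (rule ccontr)
    assume "\<not> g y \<le> g x"
    then have "y \<in> {z. g x < g z}" by simp
    then obtain n where "(F ^^ n) x \<in> {z. g x < g z}"
      using minimal_system_visits[OF F lsc] by metis
    then show False by (simp add: orbit)
  qed
  then show ?thesis by (intro antisym)
qed

section \<open>Birkhoff sums\<close>

lemma birkhoff_sum_0: "birkhoff_sum F \<gamma> 0 x = \<gamma> x"
  by (simp add: birkhoff_sum_def)

lemma birkhoff_sum_add:
  "birkhoff_sum F \<gamma> (Suc (m + n)) x = birkhoff_sum F \<gamma> m x + birkhoff_sum F \<gamma> n ((F ^^ Suc m) x)"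
proof (induction n)
  case 0
  show ?case by (simp add: birkhoff_sum_def)
next
  case (Suc n)
  have "(F ^^ Suc (m + Suc n)) x = (F ^^ Suc n) ((F ^^ Suc m) x)"
    by (metis add.commute add_Suc comp_apply funpow_add)
  with Suc show ?case
    by (simp add: birkhoff_sum_def)
qed

lemma birkhoff_sum_Suc: "birkhoff_sum F \<gamma> (Suc n) x = \<gamma> x + birkhoff_sum F \<gamma> n (F x)"
  using birkhoff_sum_add[of F \<gamma> 0 n x] by (simp add: birkhoff_sum_0)

lemma birkhoff_sum_uminus: "birkhoff_sum F (\<lambda>x. - \<gamma> x) n x = - birkhoff_sum F \<gamma> n x"
  by (simp add: birkhoff_sum_def sum_negf)

lemma birkhoff_sum_telescope:
  assumes "cohomological_solution F \<gamma> \<phi>"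
  shows "birkhoff_sum F \<gamma> n x = \<phi> ((F ^^ Suc n) x) - \<phi> x"
proof -
  have "\<gamma> y = \<phi> (F y) - \<phi> y" for y
    using assms by (simp add: cohomological_solution_def)
  then show ?thesis
    by (induction n) (simp_all add: birkhoff_sum_def)
qed

lemma continuous_on_birkhoff_sum:
  assumes "minimal_system F" "continuous_on UNIV \<gamma>"
  shows "continuous_on UNIV (birkhoff_sum F \<gamma> n)"
  unfolding birkhoff_sum_def
  by (intro continuous_on_sum continuous_on_compose2[OF assms(2) continuous_on_iterate[OF assms(1)]])
    simp

lemma uniformly_bounded_sums_iff:
  "uniformly_bounded_sums F \<gamma> \<longleftrightarrow> (\<exists>B. \<forall>n x. \<bar>birkhoff_sum F \<gamma> n x\<bar> \<le> B)"
proof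
  let ?S = "SUP n. SUP x. ereal \<bar>birkhoff_sum F \<gamma> n x\<bar>"
  assume "uniformly_bounded_sums F \<gamma>"
  then have "?S \<noteq> \<infinity>" unfolding uniformly_bounded_sums_def by (rule less_imp_neq)
  then obtain B where B: "?S < ereal B"
    unfolding less_PInf_Ex_of_nat by (elim exE)
  have "\<bar>birkhoff_sum F \<gamma> n x\<bar> \<le> B" for n x
  proof -
    have "ereal \<bar>birkhoff_sum F \<gamma> n x\<bar> \<le> ?S"
      by (rule SUP_upper2[of n], simp, rule SUP_upper, simp)
    with B have "ereal \<bar>birkhoff_sum F \<gamma> n x\<bar> < ereal B"
      by (rule le_less_trans[rotated])
    then show ?thesis by simp
  qed
  then show "\<exists>B. \<forall>n x. \<bar>birkhoff_sum F \<gamma> n x\<bar> \<le> B" by blast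
next
  assume "\<exists>B. \<forall>n x. \<bar>birkhoff_sum F \<gamma> n x\<bar> \<le> B"
  then obtain B where "\<And>n x. \<bar>birkhoff_sum F \<gamma> n x\<bar> \<le> B" by blast
  then have "(SUP n. SUP x. ereal \<bar>birkhoff_sum F \<gamma> n x\<bar>) \<le> ereal B"
    by (intro SUP_least) simp
  then show "uniformly_bounded_sums F \<gamma>"
    unfolding uniformly_bounded_sums_def by (rule le_less_trans) simp
qed

text \<open>
  Recurrence prevents the sums along an orbit from staying away from zero on the positive side,
  because an almost maximal sum could then be increased by first following the orbit until it
  comes close to \<open>y\<close> again.
\<close>

lemma exists_birkhoff_sum_less:
  fixes \<gamma> :: "'a::topological_space \<Rightarrow> real"
  assumes F: "minimal_system F" and \<gamma>: "continuous_on UNIV \<gamma>"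
    and bdd: "\<And>n. birkhoff_sum F \<gamma> n y \<le> B" and "0 < \<epsilon>"
  obtains n where "birkhoff_sum F \<gamma> n y < \<epsilon>"
proof (rule ccontr)
  assume "\<not> thesis"
  with that have ge: "\<epsilon> \<le> birkhoff_sum F \<gamma> n y" for n
    by (meson not_less)
  define L where "L = (SUP n. birkhoff_sum F \<gamma> n y)"
  have bdd': "bdd_above (range (\<lambda>n. birkhoff_sum F \<gamma> n y))"
    using bdd by (intro bdd_aboveI[of _ B]) auto
  have le: "birkhoff_sum F \<gamma> n y \<le> L" for n
    unfolding L_def by (rule cSUP_upper[OF UNIV_I bdd'])
  have "L - \<epsilon> / 2 < L" using \<open>0 < \<epsilon>\<close> by simp
  then obtain n where n: "L - \<epsilon> / 2 < birkhoff_sum F \<gamma> n y"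
    unfolding L_def using less_cSUP_iff[OF UNIV_not_empty bdd'] by blast
  define U where "U = {z. birkhoff_sum F \<gamma> n y - \<epsilon> / 2 < birkhoff_sum F \<gamma> n z}"
  have "open U"
    unfolding U_def
    by (intro open_Collect_less continuous_on_const continuous_on_birkhoff_sum[OF F \<gamma>])
  moreover have "y \<in> U" using \<open>0 < \<epsilon>\<close> by (simp add: U_def)
  \<comment> \<open>Starting the search at \<open>F y\<close> excludes the trivial return at time zero.\<close>
  ultimately obtain m where "(F ^^ m) (F y) \<in> U"
    using minimal_system_visits[OF F] by metis
  then have "birkhoff_sum F \<gamma> n y - \<epsilon> / 2 < birkhoff_sum F \<gamma> n ((F ^^ Suc m) y)"
    by (simp add: U_def funpow_swap1)
  with n ge[of m] have "L < birkhoff_sum F \<gamma> (Suc (m + n)) y"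
    by (simp add: birkhoff_sum_add)
  with le show False by (meson not_less)
qed

section \<open>The supremum of the negated sums\<close>

context
  fixes F :: "'a::topological_space \<Rightarrow> 'a" and \<gamma> :: "'a \<Rightarrow> real" and B :: real
  assumes F: "minimal_system F" and \<gamma>: "continuous_on UNIV \<gamma>"
    and bdd: "\<And>n x. \<bar>birkhoff_sum F \<gamma> n x\<bar> \<le> B"
begin

lemma bdd_above_uminus_birkhoff_sum: "bdd_above (range (\<lambda>n. - birkhoff_sum F \<gamma> n x))"
  using bdd by (intro bdd_aboveI[of _ B]) (auto simp: abs_le_iff)

lemma uminus_birkhoff_sum_le_sup_solution: "- birkhoff_sum F \<gamma> n x \<le> sup_solution F \<gamma> x"
  unfolding sup_solution_def by (rule cSUP_upper[OF UNIV_I bdd_above_uminus_birkhoff_sum])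

lemma sup_solution_least: "(\<And>n. - birkhoff_sum F \<gamma> n x \<le> a) \<Longrightarrow> sup_solution F \<gamma> x \<le> a"
  unfolding sup_solution_def by (rule cSUP_least) auto

lemma abs_sup_solution_le: "\<bar>sup_solution F \<gamma> x\<bar> \<le> B"
proof -
  have "sup_solution F \<gamma> x \<le> B"
    using bdd by (intro sup_solution_least) (simp add: abs_le_iff)
  moreover have "- B \<le> sup_solution F \<gamma> x"
    using bdd[of 0 x] uminus_birkhoff_sum_le_sup_solution[of 0 x] by linarith
  ultimately show ?thesis by (simp add: abs_le_iff)
qed

lemma sup_solution_nonneg: "0 \<le> sup_solution F \<gamma> x"
proof (rule field_le_epsilon)
  fix \<epsilon> :: real assume "0 < \<epsilon>"
  moreover have "birkhoff_sum F \<gamma> n x \<le> B" for n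
    using bdd[of n x] by linarith
  ultimately obtain n where "birkhoff_sum F \<gamma> n x < \<epsilon>"
    using exists_birkhoff_sum_less[OF F \<gamma>] by metis
  then show "0 \<le> sup_solution F \<gamma> x + \<epsilon>"
    using uminus_birkhoff_sum_le_sup_solution[of n x] by linarith
qed

text \<open>
  Nonnegativity at \<open>F x\<close> says exactly that the term \<open>n = 0\<close> of the supremum at \<open>x\<close> is at
  most the supremum of the later terms, and the terms \<open>n \<ge> 1\<close> are those of the supremum at \<open>F x\<close>, shifted by \<open>- \<gamma> x\<close>.
\<close>

lemma sup_solution_solves: "sup_solution F \<gamma> (F x) - sup_solution F \<gamma> x = \<gamma> x"
proof -
  have "sup_solution F \<gamma> x \<le> sup_solution F \<gamma> (F x) - \<gamma> x"
  proof (rule sup_solution_least)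
    fix n
    show "- birkhoff_sum F \<gamma> n x \<le> sup_solution F \<gamma> (F x) - \<gamma> x"
    proof (cases n)
      case 0
      then show ?thesis using sup_solution_nonneg[of "F x"] by (simp add: birkhoff_sum_0)
    next
      case (Suc k)
      then show ?thesis
        using uminus_birkhoff_sum_le_sup_solution[of k "F x"] by (simp add: birkhoff_sum_Suc)
    qed
  qed
  moreover have "sup_solution F \<gamma> (F x) \<le> sup_solution F \<gamma> x + \<gamma> x"
  proof (rule sup_solution_least)
    fix n
    show "- birkhoff_sum F \<gamma> n (F x) \<le> sup_solution F \<gamma> x + \<gamma> x"
      using uminus_birkhoff_sum_le_sup_solution[of "Suc n" x] by (simp add: birkhoff_sum_Suc)
  qed
  ultimately show ?thesis by linarith
qed

lemma sup_solution_lower_semicontinuous: "open {x. a < sup_solution F \<gamma> x}"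
proof -
  have "{x. a < sup_solution F \<gamma> x} = (\<Union>n. {x. a < - birkhoff_sum F \<gamma> n x})"
    unfolding sup_solution_def
    using less_cSUP_iff[OF UNIV_not_empty bdd_above_uminus_birkhoff_sum] by auto
  moreover have "open {x. a < - birkhoff_sum F \<gamma> n x}" for n
    by (intro open_Collect_less continuous_on_const continuous_on_minus
        continuous_on_birkhoff_sum[OF F \<gamma>])
  ultimately show ?thesis by auto
qed

end

lemma lower_semicontinuous_add:
  fixes f g :: "'a::topological_space \<Rightarrow> real"
  assumes "\<And>a. open {x. a < f x}" "\<And>a. open {x. a < g x}"
  shows "open {x. a < f x + g x}"
proof -
  have "{x. a < f x + g x} = (\<Union>r. {x. r < f x} \<inter> {x. a - r < g x})" (is "?L = ?R")
  proof
    show "?L \<subseteq> ?R"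
    proof
      fix x assume "x \<in> ?L"
      then have "a - g x < f x" by simp
      then obtain r where "a - g x < r" "r < f x" using dense by blast
      then have "r < f x" "a - r < g x" by simp_all
      then show "x \<in> ?R" by blast
    qed
  qed auto
  then show ?thesis
    using assms by (simp add: open_UN open_Int)
qed

lemma continuous_on_if_open_level_sets:
  fixes f :: "'a::topological_space \<Rightarrow> real"
  assumes "\<And>a. open {x. a < f x}" "\<And>a. open {x. f x < a}"
  shows "continuous_on UNIV f"
  unfolding continuous_on_def
proof
  fix x
  have "(f \<longlongrightarrow> f x) (nhds x)"
  proof (rule order_tendstoI)
    fix a assume "a < f x"
    then show "\<forall>\<^sub>F y in nhds x. a < f y"
      using eventually_nhds_in_open[OF assms(1)[of a], of x] by simp
  next
    fix a assume "f x < a"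
    then show "\<forall>\<^sub>F y in nhds x. f y < a"
      using eventually_nhds_in_open[OF assms(2)[of a], of x] by simp
  qed
  then show "(f \<longlongrightarrow> f x) (at x)"
    unfolding tendsto_at_iff_tendsto_nhds .
qed

text \<open>
  Upper semicontinuity is obtained from the corresponding supremum for \<open>- \<gamma>\<close>: the sum of the two
  is an invariant lower semicontinuous function, hence a constant \<open>c\<close>.
\<close>

lemma continuous_on_sup_solution:
  fixes F :: "'a::topological_space \<Rightarrow> 'a" and \<gamma> :: "'a \<Rightarrow> real"
  assumes F: "minimal_system F" and \<gamma>: "continuous_on UNIV \<gamma>"
    and bdd: "\<And>n x. \<bar>birkhoff_sum F \<gamma> n x\<bar> \<le> B"
  shows "continuous_on UNIV (sup_solution F \<gamma>)"
proof -
  define \<phi> where "\<phi> = sup_solution F \<gamma>"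
  define \<phi>' where "\<phi>' = sup_solution F (\<lambda>x. - \<gamma> x)"
  have \<gamma>': "continuous_on UNIV (\<lambda>x. - \<gamma> x)"
    by (intro continuous_on_minus \<gamma>)
  have bdd': "\<bar>birkhoff_sum F (\<lambda>x. - \<gamma> x) n x\<bar> \<le> B" for n x
    using bdd by (simp add: birkhoff_sum_uminus)
  have lsc: "open {x. a < \<phi> x}" and lsc': "open {x. a < \<phi>' x}" for a
    unfolding \<phi>_def \<phi>'_def
    by (rule sup_solution_lower_semicontinuous[OF F \<gamma> bdd],
        rule sup_solution_lower_semicontinuous[OF F \<gamma>' bdd'])
  have inv: "\<phi> (F x) + \<phi>' (F x) = \<phi> x + \<phi>' x" for x
    using sup_solution_solves[OF F \<gamma> bdd, of x] sup_solution_solves[OF F \<gamma>' bdd', of x]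
    unfolding \<phi>_def \<phi>'_def by linarith
  \<comment> \<open>The value at any point will do; \<open>undefined\<close> serves as base point.\<close>
  define c where "c = \<phi> undefined + \<phi>' undefined"
  have c: "\<phi> x + \<phi>' x = c" for x
    unfolding c_def
    using invariant_lower_semicontinuous_constant
      [of F "\<lambda>x. \<phi> x + \<phi>' x" x undefined, OF F lower_semicontinuous_add[OF lsc lsc'] inv] .
  have "\<phi> x < a \<longleftrightarrow> c - a < \<phi>' x" for x a
    using c[of x] by linarith
  then have "open {x. \<phi> x < a}" for a
    using lsc'[of "c - a"] by simp
  then show ?thesis
    using continuous_on_if_open_level_sets lsc unfolding \<phi>_def by blast
qed

section \<open>Bounded continuous solutions\<close>

lemma bcontfun_solution_imp:
  fixes \<gamma> :: "'a::topological_space \<Rightarrow> real"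
  assumes F: "minimal_system F" and \<phi>: "\<phi> \<in> bcontfun" and sol: "cohomological_solution F \<gamma> \<phi>"
  shows "\<gamma> \<in> bcontfun" "uniformly_bounded_sums F \<gamma>"
proof -
  have cont: "continuous_on UNIV \<phi>" and "bounded (range \<phi>)"
    using \<phi> by (auto simp: bcontfun_def)
  then obtain B where B: "\<bar>\<phi> x\<bar> \<le> B" for x
    by (auto simp: bounded_iff)
  have sums: "\<bar>birkhoff_sum F \<gamma> n x\<bar> \<le> 2 * B" for n x
    using B[of "(F ^^ Suc n) x"] B[of x] unfolding birkhoff_sum_telescope[OF sol] by linarith
  then show "uniformly_bounded_sums F \<gamma>"
    unfolding uniformly_bounded_sums_iff by blast
  have "\<gamma> = (\<lambda>x. \<phi> (F x) - \<phi> x)"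
    using sol by (simp add: cohomological_solution_def fun_eq_iff)
  moreover have "continuous_on UNIV (\<lambda>x. \<phi> (F x) - \<phi> x)"
    using F by (intro continuous_on_diff cont continuous_on_compose2[OF cont])
      (auto simp: minimal_system_def dynamical_system_def)
  moreover have "bounded (range \<gamma>)"
    using sums[of 0] by (auto simp: bounded_iff birkhoff_sum_0)
  ultimately show "\<gamma> \<in> bcontfun"
    by (simp add: bcontfun_def)
qed

lemma sup_solution_bcontfun_solution:
  fixes \<gamma> :: "'a::topological_space \<Rightarrow> real"
  assumes F: "minimal_system F" and "\<gamma> \<in> bcontfun" "uniformly_bounded_sums F \<gamma>"
  shows "sup_solution F \<gamma> \<in> bcontfun" "cohomological_solution F \<gamma> (sup_solution F \<gamma>)"
proof -
  have \<gamma>: "continuous_on UNIV \<gamma>"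
    using assms(2) by (simp add: bcontfun_def)
  obtain B where bdd: "\<And>n x. \<bar>birkhoff_sum F \<gamma> n x\<bar> \<le> B"
    using assms(3) unfolding uniformly_bounded_sums_iff by blast
  have "bounded (range (sup_solution F \<gamma>))"
    using abs_sup_solution_le[OF F \<gamma> bdd] by (auto simp: bounded_iff)
  then show "sup_solution F \<gamma> \<in> bcontfun"
    using continuous_on_sup_solution[OF F \<gamma> bdd] by (simp add: bcontfun_def)
  show "cohomological_solution F \<gamma> (sup_solution F \<gamma>)"
    using sup_solution_solves[OF F \<gamma> bdd] by (simp add: cohomological_solution_def)
qed

lemma continuous_solutions_differ_by_constant:
  fixes \<phi> \<psi> :: "'a::topological_space \<Rightarrow> real"
  assumes F: "minimal_system F"
    and cont: "continuous_on UNIV \<phi>" "continuous_on UNIV \<psi>"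
    and sol: "cohomological_solution F \<gamma> \<phi>" "cohomological_solution F \<gamma> \<psi>"
  shows "\<exists>c. \<forall>x. \<psi> x = \<phi> x + c"
proof -
  have lsc: "open {x. a < \<psi> x - \<phi> x}" for a
    by (intro open_Collect_less continuous_on_const continuous_on_diff cont)
  have inv: "\<psi> (F x) - \<phi> (F x) = \<psi> x - \<phi> x" for x
  proof -
    have "\<phi> (F x) - \<phi> x = \<gamma> x" "\<psi> (F x) - \<psi> x = \<gamma> x"
      using sol by (simp_all add: cohomological_solution_def)
    then show ?thesis by linarith
  qed
  have "\<psi> x - \<phi> x = \<psi> undefined - \<phi> undefined" for x
    using invariant_lower_semicontinuous_constant
      [of F "\<lambda>x. \<psi> x - \<phi> x" x undefined, OF F lsc inv] .
  then have "\<forall>x. \<psi> x = \<phi> x + (\<psi> undefined - \<phi> undefined)"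
    by (simp add: algebra_simps)
  then show ?thesis by blast
qed

theorem theorem6p2:
  fixes F :: "'a::topological_space \<Rightarrow> 'a" and \<gamma> :: "'a \<Rightarrow> real"
  assumes "minimal_system F"
  shows "((\<exists>\<phi>\<in>bcontfun. cohomological_solution F \<gamma> \<phi>) \<longleftrightarrow>
            \<gamma> \<in> bcontfun \<and> uniformly_bounded_sums F \<gamma>) \<and>
         (\<gamma> \<in> bcontfun \<and> uniformly_bounded_sums F \<gamma> \<longrightarrow>
            sup_solution F \<gamma> \<in> bcontfun \<and>
            cohomological_solution F \<gamma> (sup_solution F \<gamma>) \<and>
            (\<forall>\<psi>\<in>bcontfun. cohomological_solution F \<gamma> \<psi> \<longleftrightarrow>
               (\<exists>c. \<forall>x. \<psi> x = sup_solution F \<gamma> x + c)))"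
proof (intro conjI impI)
  show "(\<exists>\<phi>\<in>bcontfun. cohomological_solution F \<gamma> \<phi>) \<longleftrightarrow>
      \<gamma> \<in> bcontfun \<and> uniformly_bounded_sums F \<gamma>"
    using bcontfun_solution_imp[OF assms] sup_solution_bcontfun_solution[OF assms] by blast
next
  assume "\<gamma> \<in> bcontfun \<and> uniformly_bounded_sums F \<gamma>"
  then have bcont: "sup_solution F \<gamma> \<in> bcontfun"
    and sol: "cohomological_solution F \<gamma> (sup_solution F \<gamma>)"
    using sup_solution_bcontfun_solution[OF assms] by blast+
  show "sup_solution F \<gamma> \<in> bcontfun" by (fact bcont)
  show "cohomological_solution F \<gamma> (sup_solution F \<gamma>)" by (fact sol)
  show "\<forall>\<psi>\<in>bcontfun. cohomological_solution F \<gamma> \<psi> \<longleftrightarrow>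
      (\<exists>c. \<forall>x. \<psi> x = sup_solution F \<gamma> x + c)"
  proof (intro ballI iffI)
    fix \<psi> :: "'a \<Rightarrow> real"
    assume "\<psi> \<in> bcontfun" "cohomological_solution F \<gamma> \<psi>"
    then show "\<exists>c. \<forall>x. \<psi> x = sup_solution F \<gamma> x + c"
      using continuous_solutions_differ_by_constant[OF assms _ _ sol] bcont
      by (simp add: bcontfun_def)
  next
    fix \<psi> :: "'a \<Rightarrow> real"
    assume "\<exists>c. \<forall>x. \<psi> x = sup_solution F \<gamma> x + c"
    then show "cohomological_solution F \<gamma> \<psi>"
      using sol by (auto simp: cohomological_solution_def)
  qed
qed

end
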